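(* Let $P, Q$ be integers such that either $Q \geq 0$ and $P > 2\sqrt{Q}$, or $Q \geq 0$ and $P < -2\sqrt{Q}$. Then the Lucas sequence of first kind $(U_n(P,Q))_{n\in\mathbb{N}}$ is $1$-fold log-concave.
   Context: $\mathbb{N}=\{0,1,2,\dots\}$. For integers $P,Q$ with $P^2-4Q\geq 0$, the Lucas sequence of first kind $U_n=U_n(P,Q)$ is defined by $U_0=0$, $U_1=1$, $U_n=PU_{n-1}-QU_{n-2}$ for $n\geq 2$. Every real sequence $(a_n)_{n\in\mathbb{N}}$ is extended to indices in $\mathbb{Z}$ by the convention $a_n=0$ for $n<0$. The log-operator $\mathcal{L}$ sends a real sequence $(a_n)_{n\in\mathbb{N}}$ to the real sequence $(b_n)_{n\in\mathbb{N}}$ with $b_n=\mathcal{L}(a_n)=a_n^2-a_{n-1}a_{n+1}$ (in particular $b_0=a_0^2$). A real sequence is log-concave, equivalently $1$-fold log-concave, if $\mathcal{L}(a_n)\geq 0$ for all $n\in\mathbb{N}$. *)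

theory Defs
  imports Complex_Main
begin

fun lucas_U :: "int \<Rightarrow> int \<Rightarrow> nat \<Rightarrow> int" where
  "lucas_U P Q 0 = 0"
| "lucas_U P Q (Suc 0) = 1"
| "lucas_U P Q (Suc (Suc n)) = P * lucas_U P Q (Suc n) - Q * lucas_U P Q n"

definition zero_extend :: "(nat \<Rightarrow> real) \<Rightarrow> int \<Rightarrow> real" where
  "zero_extend a i = (if i < 0 then 0 else a (nat i))"

(* The extension to integer indices is used because n - 1 on nat would give
   index 0, not -1, at n = 0. *)
definition log_op :: "(nat \<Rightarrow> real) \<Rightarrow> nat \<Rightarrow> real" where
  "log_op a n =
     (zero_extend a (int n))\<^sup>2 - zero_extend a (int n - 1) * zero_extend a (int n + 1)"

definition log_concave :: "(nat \<Rightarrow> real) \<Rightarrow> bool" where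
  "log_concave a \<longleftrightarrow> (\<forall>n. log_op a n \<ge> 0)"

end

theory Submission
  imports Defs
begin

text \<open>A Cassini-type identity (\<open>lucas_U_cassini\<close>) shows that the log-operator
  sends U to powers of Q at positive indices (\<open>log_op_lucas_U\<close>), nonnegative since Q
  \<ge> 0; at index 0 it gives a square.\<close>

text \<open>The left side is a 2x2 determinant of consecutive terms; each index shift multiplies it
  by Q, the determinant of the companion matrix.\<close>

lemma lucas_U_cassini:
  "(lucas_U P Q (Suc n))\<^sup>2 - lucas_U P Q n * lucas_U P Q (Suc (Suc n)) = Q ^ n"
proof (induction n)
  case 0
  show ?case by simp
next
  case (Suc n)
  have "(lucas_U P Q (Suc (Suc n)))\<^sup>2 - lucas_U P Q (Suc n) * lucas_U P Q (Suc (Suc (Suc n)))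
      = Q * ((lucas_U P Q (Suc n))\<^sup>2 - lucas_U P Q n * lucas_U P Q (Suc (Suc n)))"
    by (simp add: algebra_simps power2_eq_square)
  then show ?case
    by (simp only: Suc.IH power_Suc)
qed

lemma log_op_0: "log_op a 0 = (a 0)\<^sup>2"
  by (simp add: log_op_def zero_extend_def)

lemma log_op_Suc: "log_op a (Suc n) = (a (Suc n))\<^sup>2 - a n * a (Suc (Suc n))"
  by (simp add: log_op_def zero_extend_def nat_add_distrib)

lemma log_op_lucas_U: "log_op (\<lambda>n. real_of_int (lucas_U P Q n)) (Suc n) = real_of_int (Q ^ n)"
  \<comment> \<open>Expanding \<open>Q ^ n\<close> by the identity leaves only the cast to
    distribute.\<close>
  unfolding log_op_Suc lucas_U_cassini[of P Q n, symmetric] by simp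

theorem theorem11:
  fixes P Q :: int
  assumes "(Q \<ge> 0 \<and> real_of_int P > 2 * sqrt (real_of_int Q)) \<or>
           (Q \<ge> 0 \<and> real_of_int P < - 2 * sqrt (real_of_int Q))"
  shows "log_concave (\<lambda>n. real_of_int (lucas_U P Q n))"
  unfolding log_concave_def
proof
  fix n
  have "Q \<ge> 0"
    using assms by blast
  then show "log_op (\<lambda>n. real_of_int (lucas_U P Q n)) n \<ge> 0"
    by (cases n) (simp_all add: log_op_0 log_op_lucas_U)
qed

end
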